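(* Let $a,b,r$ be integers with $r\geqslant 1$, and let $\mathcal{G}=(\mathcal{G}_n)_{n\geqslant 0}$ be the sequence with $\mathcal{G}_0=a$, $\mathcal{G}_1=b$ and $\mathcal{G}_n=r\mathcal{G}_{n-1}+\mathcal{G}_{n-2}$ for $n\geqslant 2$. Let $\tilde{\mathcal{G}}=(\tilde{\mathcal{G}}_n)_{n\geqslant 0}$ with $\tilde{\mathcal{G}}_n=(-1)^n\mathcal{G}_n$. Then for every nonnegative integer $n$, $$\det T_{\tilde{\mathcal{G}},\mathcal{G}}(n)=\begin{cases} a & \text{if } n=0,\\ (2b-ar)^{n-1}\,(a\mathcal{G}_{n-1}+b\mathcal{G}_n) & \text{if } n\geqslant 1.\end{cases}$$
   Context: For sequences $\alpha=(\alpha_i)_{i\geqslant 0}$ and $\beta=(\beta_i)_{i\geqslant 0}$ with $\alpha_0=\beta_0$, $T_{\alpha,\beta}(n)=[T_{i,j}]_{0\leqslant i,j\leqslant n}$ is the Toeplitz matrix of order $n+1$ with first column $T_{i,0}=\alpha_i$ and first row $T_{0,i}=\beta_i$ ($0\leqslant i\leqslant n$), and $T_{i,j}=T_{k,l}$ whenever $i-j=k-l$. The convention $x^0=1$ (including $x=0$) is used. *)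

theory Defs
  imports "Jordan_Normal_Form.Determinant"
begin

text \<open>
  First column \<open>\<alpha>\<close>, first row \<open>\<beta>\<close>; the argument \<open>n\<close> gives a matrix of order \<open>n + 1\<close>.
  The corner entry is taken from \<open>\<alpha>\<close>, so the first row is \<open>\<beta>\<close> only if \<open>\<alpha> 0 = \<beta> 0\<close>.
\<close>

definition toeplitz :: "(nat \<Rightarrow> 'a) \<Rightarrow> (nat \<Rightarrow> 'a) \<Rightarrow> nat \<Rightarrow> 'a mat" where
  "toeplitz \<alpha> \<beta> n =
     mat (n + 1) (n + 1) (\<lambda>(i, j). if j \<le> i then \<alpha> (i - j) else \<beta> (j - i))"

lemma toeplitz_first_col: "i \<le> n \<Longrightarrow> toeplitz \<alpha> \<beta> n $$ (i, 0) = \<alpha> i"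
  by (simp add: toeplitz_def)

lemma toeplitz_first_row:
  "\<alpha> 0 = \<beta> 0 \<Longrightarrow> j \<le> n \<Longrightarrow> toeplitz \<alpha> \<beta> n $$ (0, j) = \<beta> j"
  by (simp add: toeplitz_def)

lemma toeplitz_diagonal:
  assumes "i \<le> n" "j \<le> n" "k \<le> n" "l \<le> n" "int i - int j = int k - int l"
  shows "toeplitz \<alpha> \<beta> n $$ (i, j) = toeplitz \<alpha> \<beta> n $$ (k, l)"
proof -
  have "j \<le> i \<longleftrightarrow> l \<le> k" "i - j = k - l" "j - i = l - k"
    using assms(5) by linarith+
  then show ?thesis
    using assms(1-4) by (simp add: toeplitz_def)
qed

end

theory Submission
  imports Defs
begin

text \<open>
  The Toeplitz entry at \<open>(i, j)\<close> is \<open>f (j - i)\<close> for the two-sided sequence with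
  \<open>f m = G m\<close> and \<open>f (- m) = (-1)^m * G m\<close>. This \<open>f\<close> satisfies
  \<open>f k = r * f (k - 1) + f (k - 2)\<close> for every integer \<open>k\<close> except \<open>k = 1\<close>, where the defect
  is \<open>2 * b - a * r\<close>. Subtracting \<open>r\<close> times the preceding column and once the one before
  that from each column with index at least 2 thus leaves a single nonzero entry in it,
  just above the diagonal, and expanding along these columns reduces the
  determinant to a 2 by 2 minor formed by the first two columns and the outer rows.
\<close>

text \<open>The shape left after the column reduction. Keeping \<open>u\<close> and \<open>v\<close>
  arbitrary makes the family closed under the deletion used in the induction.\<close>

definition superdiag_mat :: "'a::zero \<Rightarrow> (nat \<Rightarrow> 'a) \<Rightarrow> (nat \<Rightarrow> 'a) \<Rightarrow> nat \<Rightarrow> 'a mat" where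
  "superdiag_mat c u v n = mat (n + 1) (n + 1)
     (\<lambda>(i, j). if j = 0 then u i else if j = 1 then v i else if j = i + 1 then c else 0)"

lemma mat_delete_superdiag_mat:
  assumes "n \<ge> 1"
  shows "mat_delete (superdiag_mat c u v (Suc n)) n (Suc n) =
    superdiag_mat c (\<lambda>i. if i < n then u i else u (Suc i)) (\<lambda>i. if i < n then v i else v (Suc i)) n"
  using assms by (intro eq_matI) (auto simp: mat_delete_def superdiag_mat_def)

lemma det_superdiag_mat:
  fixes c :: "'a::comm_ring_1"
  assumes "n \<ge> 1"
  shows "det (superdiag_mat c u v n) = (- c) ^ (n - 1) * (u 0 * v n - v 0 * u n)"
  using assms
proof (induction n arbitrary: u v rule: dec_induct)
  case base
  let ?M = "superdiag_mat c u v 1"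
  have M: "?M \<in> carrier_mat 2 2"
    by (auto simp: superdiag_mat_def)
  have "det ?M = (\<Sum>i<2. ?M $$ (i, 1) * cofactor ?M i 1)"
    using M by (intro laplace_expansion_column) auto
  also have "\<dots> = u 0 * v 1 - v 0 * u 1"
    by (simp add: numeral_2_eq_2 cofactor_def mat_delete_def det_single superdiag_mat_def)
  finally show ?case
    by simp
next
  case (step n)
  let ?M = "superdiag_mat c u v (Suc n)"
  have M: "?M \<in> carrier_mat (n + 2) (n + 2)"
    by (simp add: superdiag_mat_def)
  have "det ?M = (\<Sum>i<n + 2. ?M $$ (i, Suc n) * cofactor ?M i (Suc n))"
    using M by (intro laplace_expansion_column) auto
  also have "\<dots> = (\<Sum>i<n + 2. if i = n then c * cofactor ?M n (Suc n) else 0)"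
    using step.hyps by (intro sum.cong) (auto simp: superdiag_mat_def)
  \<comment> \<open>The cofactor sign is -1 because \<open>n + Suc n\<close> is odd.\<close>
  also have "\<dots> = - c * det (mat_delete ?M n (Suc n))"
    by (simp add: cofactor_def)
  \<comment> \<open>Deleting row \<open>n\<close> moves the last row into its place and, as
    \<open>n \<ge> 1\<close>, leaves row 0 alone.\<close>
  also have "\<dots> = (- c) ^ Suc (n - 1) * (u 0 * v (Suc n) - v 0 * u (Suc n))"
    using step.hyps by (simp add: mat_delete_superdiag_mat step.IH del: Suc_diff_Suc Suc_pred)
  finally show ?case
    using step.hyps by (simp del: power_Suc)
qed

text \<open>Right multiplication by this matrix performs all the column subtractions at once, each
  with the original columns.\<close>

definition recurrence_mat :: "'a::comm_ring_1 \<Rightarrow> nat \<Rightarrow> 'a mat" where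
  "recurrence_mat r n = mat (n + 1) (n + 1)
     (\<lambda>(k, j). (if k = j then 1 else 0) - (if j \<ge> 2 \<and> k = j - 1 then r else 0)
       - (if j \<ge> 2 \<and> k = j - 2 then 1 else 0))"

lemma det_recurrence_mat: "det (recurrence_mat r n) = 1"
proof -
  have "upper_triangular (recurrence_mat r n)"
    by (intro upper_triangularI) (auto simp: recurrence_mat_def)
  moreover have "recurrence_mat r n \<in> carrier_mat (n + 1) (n + 1)"
    by (simp add: recurrence_mat_def)
  moreover have "diag_mat (recurrence_mat r n) = replicate (n + 1) 1"
    unfolding diag_mat_def
    by (rule nth_equalityI) (auto simp: recurrence_mat_def simp del: upt_Suc replicate_Suc)
  ultimately show ?thesis
    by (simp add: det_upper_triangular prod_list_replicate)
qed

lemma mult_recurrence_mat_index: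
  assumes "A \<in> carrier_mat (n + 1) (n + 1)" "i \<le> n" "j \<le> n"
  shows "(A * recurrence_mat r n) $$ (i, j) =
    (if j \<ge> 2 then A $$ (i, j) - r * A $$ (i, j - 1) - A $$ (i, j - 2) else A $$ (i, j))"
proof -
  have "(A * recurrence_mat r n) $$ (i, j) =
      (\<Sum>k = 0..<n + 1. A $$ (i, k) * recurrence_mat r n $$ (k, j))"
    using assms by (simp add: recurrence_mat_def scalar_prod_def)
  \<comment> \<open>The guard \<open>j \<ge> 2\<close> moves inside, so that each summand is a delta
    in \<open>k\<close>; it also silences the truncated \<open>j - 1\<close> and
    \<open>j - 2\<close>.\<close>
  also have "\<dots> = (\<Sum>k = 0..<n + 1. (if k = j then A $$ (i, j) else 0)
      - (if k = j - 1 then if j \<ge> 2 then r * A $$ (i, j - 1) else 0 else 0)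
      - (if k = j - 2 then if j \<ge> 2 then A $$ (i, j - 2) else 0 else 0))"
    using assms by (intro sum.cong) (auto simp: recurrence_mat_def algebra_simps)
  also have "\<dots> = (if j \<ge> 2 then A $$ (i, j) - r * A $$ (i, j - 1) - A $$ (i, j - 2)
      else A $$ (i, j))"
    using assms by (auto simp: sum_subtractf)
  finally show ?thesis .
qed

lemma toeplitz_recurrence_column:
  fixes r :: "'a::comm_ring_1" and G :: "nat \<Rightarrow> 'a"
  assumes rec: "\<And>m. G (m + 2) = r * G (m + 1) + G m"
    and ij: "i \<le> n" "j \<le> n" "j \<ge> 2"
  defines "T \<equiv> toeplitz (\<lambda>m. (-1) ^ m * G m) G n"
  shows "T $$ (i, j) - r * T $$ (i, j - 1) - T $$ (i, j - 2) =
    (if j = i + 1 then 2 * G 1 - G 0 * r else 0)"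
proof -
  consider m where "j = i + m + 2" | "j = i + 1" | m where "i = j + m"
    using le_Suc_ex[of "i + 2" j] le_Suc_ex[of j i] by force
  then show ?thesis
  proof cases
    case 1
    then show ?thesis
      using ij rec[of m] by (simp add: T_def toeplitz_def)
  next
    \<comment> \<open>The three entries are \<open>G 1\<close>, \<open>G 0\<close> and
      \<open>- G 1\<close>.\<close>
    case 2
    then show ?thesis
      using ij by (simp add: T_def toeplitz_def algebra_simps)
  next
    \<comment> \<open>With the alternating signs the left side is
      \<open>(-1) ^ m * (G m + r * G (m + 1) - G (m + 2))\<close>, which vanishes by the
      recurrence.\<close>
    case 3
    have "i - (j - 1) = m + 1" "i - (j - 2) = m + 2" "j - 1 \<le> i" "j - 2 \<le> i"
      using 3 ij by auto
    then show ?thesis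
      using 3 ij rec[of m] by (simp add: T_def toeplitz_def algebra_simps)
  qed
qed

lemma toeplitz_mult_recurrence_mat:
  fixes r :: "'a::comm_ring_1" and G :: "nat \<Rightarrow> 'a"
  assumes rec: "\<And>m. G (m + 2) = r * G (m + 1) + G m"
    and n: "n \<ge> 1"
  defines "T \<equiv> toeplitz (\<lambda>m. (-1) ^ m * G m) G n"
  shows "T * recurrence_mat r n =
    superdiag_mat (2 * G 1 - G 0 * r) (\<lambda>i. T $$ (i, 0)) (\<lambda>i. T $$ (i, 1)) n"
    (is "_ = ?M")
proof (rule eq_matI)
  have T: "T \<in> carrier_mat (n + 1) (n + 1)"
    by (simp add: T_def toeplitz_def)
  fix i j
  assume "i < dim_row ?M" "j < dim_col ?M"
  then have ij: "i \<le> n" "j \<le> n"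
    by (auto simp: superdiag_mat_def)
  show "(T * recurrence_mat r n) $$ (i, j) = ?M $$ (i, j)"
  proof (cases "j \<ge> 2")
    case True
    then show ?thesis
      using ij toeplitz_recurrence_column[of G, OF rec ij True]
      by (subst mult_recurrence_mat_index[OF T ij]) (simp add: T_def superdiag_mat_def)
  next
    case False
    then have "j = 0 \<or> j = 1"
      by auto
    then show ?thesis
      using ij by (subst mult_recurrence_mat_index[OF T ij]) (auto simp: superdiag_mat_def)
  qed
qed (auto simp: T_def toeplitz_def recurrence_mat_def superdiag_mat_def)

theorem theorem1:
  fixes a b r :: int and G :: "nat \<Rightarrow> int" and n :: nat
  assumes "r \<ge> 1"
    and "G 0 = a"
    and "G 1 = b"
    and "\<And>m. m \<ge> 2 \<Longrightarrow> G m = r * G (m - 1) + G (m - 2)"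
  shows "det (toeplitz (\<lambda>m. (-1) ^ m * G m) G n) =
    (if n = 0 then a else (2 * b - a * r) ^ (n - 1) * (a * G (n - 1) + b * G n))"
proof (cases "n = 0")
  case True
  then show ?thesis
    using assms(2) by (simp add: toeplitz_def det_single)
next
  case False
  then obtain m where n: "n = Suc m"
    by (cases n) auto
  have rec: "G (k + 2) = r * G (k + 1) + G k" for k
    using assms(4)[of "k + 2"] by simp
  let ?T = "toeplitz (\<lambda>m. (-1) ^ m * G m) G n"
  have "?T \<in> carrier_mat (n + 1) (n + 1)" "recurrence_mat r n \<in> carrier_mat (n + 1) (n + 1)"
    by (simp_all add: toeplitz_def recurrence_mat_def)
  then have "det ?T = det (?T * recurrence_mat r n)"
    by (simp add: det_mult det_recurrence_mat)
  also have "\<dots> = (- (2 * b - a * r)) ^ m *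
      (?T $$ (0, 0) * ?T $$ (n, 1) - ?T $$ (0, 1) * ?T $$ (n, 0))"
    using n assms(2,3) by (simp add: toeplitz_mult_recurrence_mat[of G, OF rec] det_superdiag_mat)
  \<comment> \<open>The corner entries are \<open>a\<close>, \<open>b\<close>,
    \<open>(-1) ^ m * G m\<close> and \<open>(-1) ^ n * G n\<close>. As \<open>n = Suc m\<close>,
    the minus sign of the minor becomes a plus, and the common factor \<open>(-1) ^ m\<close> then
    cancels the sign of the power.\<close>
  also have "\<dots> = (- (2 * b - a * r)) ^ m * ((-1) ^ m * (a * G m + b * G n))"
    using n assms(2,3) by (simp add: toeplitz_def algebra_simps)
  also have "\<dots> = (2 * b - a * r) ^ m * (a * G m + b * G n)"
    by (simp flip: mult.assoc power_mult_distrib)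
  finally show ?thesis
    using n by simp
qed

end
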